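(* Let $n\ge1$, let $F:\mathbb{R}^n\times\mathbb{R}\times\mathbb{R}^n\times\mathbb{S}^n\to\mathbb{R}$ be degenerate elliptic and satisfy, for all $x,p\in\mathbb{R}^n$, $X\in\mathbb{S}^n$, $$-F(x,0,p,X)\le\Lambda(x_n)\,\mathrm{Tr}(X^+)-\lambda(x_n)\,\mathrm{Tr}(X^-),$$ where $\lambda,\Lambda:[0,\infty)\to(0,\infty)$, $\lambda$ is nonincreasing and $\Lambda$ is nondecreasing. Let $\gamma:(0,\infty)\to(0,\infty)$ be nondecreasing with $\int_0^R\frac{\Lambda(s)}{\lambda(s)}\,ds\precsim\gamma(R)$. Let $u$ be a viscosity subsolution of $F(x,u,Du,D^2u)=0$ in $\mathbb{R}^n_+$ satisfying $\limsup_{x\to y}u(x)\le0$ for all $y\in\partial\mathbb{R}^n_+$, and suppose $u(\bar x)>0$ for some $\bar x\in\mathbb{R}^n_+$ on the $x_n$-axis. Then $$\liminf_{R\to\infty}\frac{M(R)}{R}>0.$$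
   Context: Notation: $\mathbb{R}^n_+=\{x\in\mathbb{R}^n:x_n>0\}$; $\mathbb{S}^n$ is the set of symmetric $n\times n$ matrices with the positive semidefinite ordering. For $X\in\mathbb{S}^n$ write $X=X^+-X^-$ with $X^\pm\ge0$, $X^+X^-=0$. Degenerate ellipticity: $F(x,u,p,X)\ge F(x,v,p,Y)$ whenever $u\ge v$ and $X\le Y$. Viscosity subsolution in a domain $\Omega$: an upper semicontinuous $u:\Omega\to\mathbb{R}$ such that whenever $\varphi\in C^2(\Omega)$ and $u-\varphi$ has a local maximum at $x_0\in\Omega$, then $F(x_0,u(x_0),D\varphi(x_0),D^2\varphi(x_0))\le0$. $D(R)=\{x\in\mathbb{R}^n_+:\sum_{i=1}^{n-1}x_i^2+(x_n+\gamma(R))^2<(R+\gamma(R))^2\}$, $M(R)=\sup_{\partial D(R)}u$ (with $u(y):=\limsup_{x\to y}u(x)$ for $y\in\partial\mathbb{R}^n_+$). $A\precsim B$ means that there is a constant $c>0$ with $A\le cB$. *)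

theory Defs
  imports "HOL-Analysis.Analysis"
begin

section \<open>Symmetric matrices\<close>

definition sym_mat :: "real ^ 'n ^ 'n \<Rightarrow> bool" where
  "sym_mat X \<longleftrightarrow> transpose X = X"

definition pos_semidef :: "real ^ 'n ^ 'n \<Rightarrow> bool" where
  "pos_semidef X \<longleftrightarrow> sym_mat X \<and> (\<forall>v. 0 \<le> v \<bullet> (X *v v))"

definition mat_le :: "real ^ 'n ^ 'n \<Rightarrow> real ^ 'n ^ 'n \<Rightarrow> bool" where
  "mat_le X Y \<longleftrightarrow> pos_semidef (Y - X)"

text \<open>\<open>P\<close> and \<open>N\<close> are the positive and negative part of \<open>X\<close>.  Every symmetric \<open>X\<close> has exactly
  one such decomposition, so quantifying over it amounts to speaking about the two parts.\<close>

definition pos_neg_parts :: "real ^ 'n ^ 'n \<Rightarrow> real ^ 'n ^ 'n \<Rightarrow> real ^ 'n ^ 'n \<Rightarrow> bool" where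
  "pos_neg_parts X P N \<longleftrightarrow> pos_semidef P \<and> pos_semidef N \<and> X = P - N \<and> P ** N = 0"

section \<open>Viscosity subsolutions\<close>

text \<open>The operator \<open>F\<close> is only meant on symmetric matrices: all conditions on \<open>F\<close> are restricted
  to them, and the Hessian of a \<open>C\<^sup>2\<close> function is symmetric.\<close>

type_synonym 'n operator = "real ^ 'n \<Rightarrow> real \<Rightarrow> real ^ 'n \<Rightarrow> real ^ 'n ^ 'n \<Rightarrow> real"

definition degenerate_elliptic :: "'n::finite operator \<Rightarrow> bool" where
  "degenerate_elliptic F \<longleftrightarrow>
     (\<forall>x u v p X Y. sym_mat X \<and> sym_mat Y \<and> u \<ge> v \<and> mat_le X Y \<longrightarrow> F x u p X \<ge> F x v p Y)"

definition usc_on :: "'a::topological_space set \<Rightarrow> ('a \<Rightarrow> real) \<Rightarrow> bool" where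
  "usc_on S u \<longleftrightarrow> (\<forall>x\<in>S. \<forall>a>u x. \<forall>\<^sub>F y in at x within S. u y < a)"

text \<open>\<open>\<phi>\<close> is of class \<open>C\<^sup>2\<close> on the open set \<open>S\<close>, with gradient \<open>D\<phi>\<close> and Hessian \<open>D2\<phi>\<close>.\<close>

definition C2_on ::
  "(real ^ 'n) set \<Rightarrow> (real ^ 'n \<Rightarrow> real) \<Rightarrow> (real ^ 'n \<Rightarrow> real ^ 'n) \<Rightarrow> (real ^ 'n \<Rightarrow> real ^ 'n ^ 'n) \<Rightarrow> bool"
  where
  "C2_on S \<phi> D\<phi> D2\<phi> \<longleftrightarrow>
     (\<forall>x\<in>S. GDERIV \<phi> x :> D\<phi> x) \<and>
     (\<forall>x\<in>S. (D\<phi> has_derivative (\<lambda>h. D2\<phi> x *v h)) (at x)) \<and>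
     continuous_on S D2\<phi>"

definition viscosity_subsolution ::
  "'n::finite operator \<Rightarrow> (real ^ 'n) set \<Rightarrow> (real ^ 'n \<Rightarrow> real) \<Rightarrow> bool" where
  "viscosity_subsolution F \<Omega> u \<longleftrightarrow>
     usc_on \<Omega> u \<and>
     (\<forall>\<phi> D\<phi> D2\<phi>. C2_on \<Omega> \<phi> D\<phi> D2\<phi> \<longrightarrow>
        (\<forall>x0\<in>\<Omega>. (\<forall>\<^sub>F x in at x0 within \<Omega>. u x - \<phi> x \<le> u x0 - \<phi> x0) \<longrightarrow>
           F x0 (u x0) (D\<phi> x0) (D2\<phi> x0) \<le> 0))"

section \<open>Half-space, the regions \<open>D(R)\<close> and the suprema \<open>M(R)\<close>\<close>

text \<open>The index type carries no order; an index \<open>k\<close> plays the role of the last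
  coordinate \<open>n\<close>, with \<open>CARD('n)\<close> as the dimension.\<close>

definition halfspace :: "'n::finite \<Rightarrow> (real ^ 'n) set" where
  "halfspace k = {x. x $ k > 0}"

definition region :: "'n::finite \<Rightarrow> (real \<Rightarrow> real) \<Rightarrow> real \<Rightarrow> (real ^ 'n) set" where
  "region k \<gamma> R =
     {x \<in> halfspace k. (\<Sum>i\<in>UNIV - {k}. (x $ i)\<^sup>2) + (x $ k + \<gamma> R)\<^sup>2 < (R + \<gamma> R)\<^sup>2}"

text \<open>The limit superior may be \<open>-\<infinity>\<close>, hence extended reals.\<close>

definition boundary_ext :: "'n::finite \<Rightarrow> (real ^ 'n \<Rightarrow> real) \<Rightarrow> real ^ 'n \<Rightarrow> ereal" where
  "boundary_ext k u y =
     (if y \<in> halfspace k then ereal (u y) else Limsup (at y within halfspace k) (\<lambda>x. ereal (u x)))"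

definition bdry_sup :: "'n::finite \<Rightarrow> (real \<Rightarrow> real) \<Rightarrow> (real ^ 'n \<Rightarrow> real) \<Rightarrow> real \<Rightarrow> ereal" where
  "bdry_sup k \<gamma> u R = (SUP y\<in>frontier (region k \<gamma> R). boundary_ext k u y)"

end

(*
  On D(R) compare u with m w, where m is any positive number at least M(R) and
    w x = A |x'|^2 + f (x_n),   A = 2 / (R^2 + 2 R gamma(R)).
  The concave profile f has f 0 = 0, slope between 2/R and O(1/R), and f'' so negative that
  lambda (-f'') outweighs Lambda Tr (2 A I); the slope bound needs exactly that the integral of
  Lambda / lambda over [0,R] is O(gamma(R)).  On the spherical part of the boundary w >= 1, because
  either |x'|^2 >= 1/A or x_n >= R/2, and w >= 0 on the flat part.  A positive maximum of u - m w
  inside D(R) contradicts the ellipticity condition, so u(xbar) <= m w(xbar) = O(m / R).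
*)
theory Submission
  imports Defs
begin

section \<open>Upper semicontinuity and attained maxima\<close>

lemma usc_on_diff_continuous:
  fixes u w :: "'a::topological_space \<Rightarrow> real"
  assumes "usc_on S u" "continuous_on S w"
  shows "usc_on S (\<lambda>x. u x - w x)"
  unfolding usc_on_def
proof (intro ballI allI impI)
  fix x a assume x: "x \<in> S" and a: "u x - w x < a"
  define e where "e = (a - (u x - w x)) / 2"
  have "e > 0" using a by (simp add: e_def)
  then have "\<forall>\<^sub>F y in at x within S. u y < u x + e"
    using assms(1) x by (auto simp: usc_on_def)
  moreover have "\<forall>\<^sub>F y in at x within S. w x - e < w y"
    using assms(2) x \<open>e > 0\<close> by (auto simp: continuous_on_def intro!: order_tendstoD)
  ultimately show "\<forall>\<^sub>F y in at x within S. u y - w y < a"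
    by eventually_elim (simp add: e_def field_simps)
qed

lemma usc_on_subset: "usc_on S u \<Longrightarrow> T \<subseteq> S \<Longrightarrow> usc_on T u"
  unfolding usc_on_def by (meson at_le filter_leD subsetD)

text \<open>If every value of \<open>v\<close> on \<open>D\<close> were exceeded, each point of
  \<open>C\<close> would have a neighbourhood on which \<open>v\<close> stays below a single value
  attained in \<open>D\<close>: semicontinuity supplies it at points of \<open>D\<close>, and
  \<open>bd\<close> supplies \<open>v z\<close> elsewhere. By compactness finitely many such values
  suffice, and the largest of them would be smaller than another one. Since \<open>bd\<close> is an
  eventual bound within \<open>D\<close>, the values of \<open>v\<close> outside \<open>D\<close>
  never matter.\<close>

lemma usc_attains_max_off_boundary:
  fixes v :: "'a::topological_space \<Rightarrow> real"
  assumes "compact C" "D \<subseteq> C" "z \<in> D" "usc_on D v"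
    and bd: "\<And>x. x \<in> C - D \<Longrightarrow> \<forall>\<^sub>F y in at x within D. v y < v z"
  obtains x0 where "x0 \<in> D" "\<And>y. y \<in> D \<Longrightarrow> v y \<le> v x0"
proof (rule ccontr)
  assume "\<not> thesis"
  with that have nomax: "\<exists>y\<in>D. v x < v y" if "x \<in> D" for x
    using \<open>x \<in> D\<close> by (meson not_less)
  have "\<exists>U y. open U \<and> x \<in> U \<and> y \<in> D \<and> (\<forall>x'\<in>U \<inter> D. v x' < v y)" if "x \<in> C" for x
  proof (cases "x \<in> D")
    case True
    then obtain y where y: "y \<in> D" "v x < v y" using nomax by blast
    then have "\<forall>\<^sub>F x' in at x within D. v x' < v y"
      using assms(4) True by (auto simp: usc_on_def)
    then obtain U where "open U" "x \<in> U" "\<And>x'. x' \<in> U \<Longrightarrow> x' \<noteq> x \<Longrightarrow> x' \<in> D \<Longrightarrow> v x' < v y"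
      unfolding eventually_at_topological by blast
    then show ?thesis using y by (intro exI[of _ U] exI[of _ y]) auto
  next
    case False
    then have "\<forall>\<^sub>F x' in at x within D. v x' < v z" using bd that by blast
    then obtain U where "open U" "x \<in> U" "\<And>x'. x' \<in> U \<Longrightarrow> x' \<noteq> x \<Longrightarrow> x' \<in> D \<Longrightarrow> v x' < v z"
      unfolding eventually_at_topological by blast
    then show ?thesis using False assms(3) by (intro exI[of _ U] exI[of _ z]) auto
  qed
  then obtain U p where U: "\<And>x. x \<in> C \<Longrightarrow> open (U x) \<and> x \<in> U x \<and> p x \<in> D \<and> (\<forall>x'\<in>U x \<inter> D. v x' < v (p x))"
    by metis
  obtain T where T: "T \<subseteq> C" "finite T" "C \<subseteq> (\<Union>x\<in>T. U x)"
    by (rule compactE_image[OF assms(1), of C U]) (use U in auto)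
  then have "T \<noteq> {}" using assms by auto
  then obtain t where t: "t \<in> T" "\<And>s. s \<in> T \<Longrightarrow> v (p s) \<le> v (p t)"
    using finite_imageI[OF T(2), of "\<lambda>s. v (p s)"]
    by (smt (verit) Max_ge Max_in empty_is_image imageE imageI)
  then have "p t \<in> D" using U T by blast
  then obtain s where "s \<in> T" "p t \<in> U s" using T assms by blast
  then have "v (p t) < v (p s)" using U T \<open>p t \<in> D\<close> by blast
  with t(2)[OF \<open>s \<in> T\<close>] show False by simp
qed

section \<open>Concave profiles with prescribed curvature\<close>

lemma real_antiderivative_exists:
  fixes f :: "real \<Rightarrow> real"
  assumes "continuous_on UNIV f"
  obtains F where "F 0 = 0" "\<And>x. (F has_real_derivative f x) (at x)"
proof -
  have "\<exists>F. \<forall>x::real. -\<infinity> < ereal x \<longrightarrow> ereal x < \<infinity> \<longrightarrow> (F has_vector_derivative f x) (at x)"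
    by (rule einterval_antiderivative) (use assms in \<open>auto simp: continuous_on_eq_continuous_at\<close>)
  then obtain F where "\<And>x. (F has_real_derivative f x) (at x)"
    by (auto simp: has_real_derivative_iff_has_vector_derivative)
  then show thesis
    by (intro that[of "\<lambda>x. F x - F 0"]) (auto intro!: derivative_eq_intros)
qed

lemma mono_on_smooth_majorant:
  fixes g :: "real \<Rightarrow> real"
  assumes R: "R > 0" and mono: "mono_on {0..R} g" and pos: "\<And>s. s \<in> {0..R} \<Longrightarrow> g s > 0"
  obtains q H where "continuous_on UNIV q" "\<And>t. (H has_real_derivative q t) (at t)"
    "\<And>t. 0 \<le> t \<Longrightarrow> t < R \<Longrightarrow> g t \<le> q t"
    "\<And>t. t \<le> R \<Longrightarrow> 0 \<le> H t \<and> H t \<le> integral {0..R} g + 1"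
proof -
  \<comment> \<open>\<open>g\<close> may be discontinuous, so the integral \<open>G\<close> of the monotone extension \<open>gr\<close> is
    averaged: \<open>(G (t + d) - G t) / d\<close> is continuous and dominates \<open>g t\<close>, and freezing \<open>gr\<close> beyond \<open>R\<close>
    keeps the excess over the integral at most \<open>d * g R = 1\<close>.\<close>
  define gr where "gr s = (if s < 0 then 0 else g (min s R))" for s
  have gr_mono: "gr s \<le> gr t" if "s \<le> t" for s t
    using that R pos[of "min t R"] by (auto simp: gr_def intro!: mono_onD[OF mono])
  have gr_nonneg: "0 \<le> gr s" for s
    using pos[of "min s R"] R by (auto simp: gr_def)
  have gr_le: "gr s \<le> g R" for s
    using mono_onD[OF mono, of "min s R" R] pos[of R] R by (auto simp: gr_def)
  have int: "gr integrable_on {a..b}" for a b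
    by (rule integrable_on_mono_on) (auto intro: mono_onI gr_mono)
  define G where "G s = integral {0..s} gr" for s
  have G_diff: "G t - G s = integral {s..t} gr" if "0 \<le> s" "s \<le> t" for s t
    using Henstock_Kurzweil_Integration.integral_combine[of 0 s t gr] that int by (simp add: G_def)
  \<comment> \<open>For negative \<open>s\<close> the interval of integration is empty, so
    \<open>G\<close> is the primitive of \<open>gr\<close> on the whole line.\<close>
  have G_neg: "G s = 0" if "s \<le> 0" for s
    using that by (cases "s = 0") (auto simp: G_def)
  have G_up: "G t - G s \<le> g R * (t - s)" and G_mono: "G s \<le> G t" if "s \<le> t" for s t
  proof -
    have *: "G t - G s \<le> g R * (t - s) \<and> G s \<le> G t" if "0 \<le> s" "s \<le> t" for s t
    proof -
      have "integral {s..t} gr \<le> integral {s..t} (\<lambda>_. g R)"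
        by (rule integral_le) (auto simp: int gr_le)
      moreover have "0 \<le> integral {s..t} gr"
        by (rule integral_nonneg) (auto simp: int gr_nonneg)
      ultimately show ?thesis using that G_diff[OF that] by (simp add: algebra_simps)
    qed
    have "0 < g R" using pos R by auto
    consider "0 \<le> s" | "s < 0" "0 \<le> t" | "t < 0" using that by linarith
    then have "G t - G s \<le> g R * (t - s) \<and> G s \<le> G t"
    proof cases
      case 2
      have "g R * t \<le> g R * (t - s)" using \<open>0 < g R\<close> 2 by simp
      then show ?thesis using *[of 0 t] 2 G_neg[of 0] G_neg[of s] by auto
    next
      case 3
      then show ?thesis using G_neg[of s] G_neg[of t] that \<open>0 < g R\<close> by simp
    qed (use * that in auto)
    then show "G t - G s \<le> g R * (t - s)" "G s \<le> G t" by auto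
  qed
  have "(g R)-lipschitz_on UNIV G"
  proof (rule lipschitz_onI)
    show "dist (G x) (G y) \<le> g R * dist x y" for x y
      using G_up[of x y] G_up[of y x] G_mono[of x y] G_mono[of y x]
      by (cases "x \<le> y") (auto simp: dist_real_def abs_if)
  qed (use pos[of R] R in auto)
  then have G_cont: "continuous_on UNIV G" by (rule lipschitz_on_continuous_on)
  obtain I where I: "\<And>x. (I has_real_derivative G x) (at x)"
    using real_antiderivative_exists[OF G_cont] by blast
  define d where "d = 1 / g R"
  have d: "d > 0" using pos R by (simp add: d_def)
  show thesis
  proof (rule that[of "\<lambda>t. (G (t + d) - G t) / d" "\<lambda>t. (I (t + d) - I t) / d"])
    show "continuous_on UNIV (\<lambda>t. (G (t + d) - G t) / d)"
      using d by (intro continuous_intros continuous_on_compose2[OF G_cont]) auto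
    show "((\<lambda>t. (I (t + d) - I t) / d) has_real_derivative (G (t + d) - G t) / d) (at t)" for t
    proof -
      have "((\<lambda>t. I (t + d)) has_real_derivative G (t + d)) (at t)"
        using I[of "t + d"] by (simp add: DERIV_shift)
      then show ?thesis using d by (auto intro!: derivative_eq_intros I)
    qed
    show "g t \<le> (G (t + d) - G t) / d" if "0 \<le> t" "t < R" for t
    proof -
      have "integral {t..t+d} (\<lambda>_. gr t) \<le> integral {t..t+d} gr"
        by (rule integral_le) (auto simp: int gr_mono)
      then have "d * gr t \<le> G (t + d) - G t" using G_diff[of t "t + d"] that d by simp
      then show ?thesis using that d by (simp add: gr_def field_simps)
    qed
    show "0 \<le> (I (t + d) - I t) / d \<and> (I (t + d) - I t) / d \<le> integral {0..R} g + 1" if "t \<le> R" for t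
    proof -
      \<comment> \<open>The averaged primitive equals \<open>G\<close> at an intermediate point, so
        the bounds on \<open>H\<close> reduce to \<open>0 \<le> G s \<le> G (R + d)\<close>.\<close>
      obtain s where s: "t < s" "s < t + d" "I (t + d) - I t = d * G s"
        using MVT2[of t "t + d" I G] I d by auto
      have "integral {0..R} gr = integral {0..R} g"
        by (rule integral_cong) (auto simp: gr_def)
      then have "G R = integral {0..R} g" by (simp add: G_def)
      moreover have "G (R + d) \<le> G R + 1"
        using G_up[of R "R + d"] d pos[of R] R by (simp add: d_def)
      moreover have "G s \<le> G (R + d)" using s that by (intro G_mono) auto
      moreover have "0 \<le> G s" using G_mono[of "min s 0" s] G_neg[of "min s 0"] by auto
      ultimately show ?thesis using s d by simp
    qed
  qed
qed

text \<open>Take \<open>f'' = - b * q\<close> with \<open>q\<close> a continuous majorant of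
  \<open>g\<close>; \<open>g\<close> itself may jump, which would spoil the \<open>C^2\<close>
  regularity of a test function. The constant of integration in \<open>f'\<close> is chosen so that
  \<open>0 \<le> H t \<le> integral {0..R} g + 1\<close> keeps \<open>f'\<close> between the two
  slopes up to \<open>R\<close>; the mean value theorem from \<open>f 0 = 0\<close> then gives the
  linear bounds.\<close>

lemma concave_profile:
  fixes g :: "real \<Rightarrow> real"
  assumes "R > 0" "mono_on {0..R} g" "\<And>s. s \<in> {0..R} \<Longrightarrow> g s > 0" "b \<ge> 0"
  obtains f f' f'' where "\<And>t. (f has_real_derivative f' t) (at t)"
    "\<And>t. (f' has_real_derivative f'' t) (at t)" "continuous_on UNIV f''"
    "\<And>t. 0 \<le> t \<Longrightarrow> t < R \<Longrightarrow> b * g t \<le> - f'' t"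
    "\<And>t. 0 \<le> t \<Longrightarrow> t \<le> R \<Longrightarrow> a * t \<le> f t \<and> f t \<le> (a + b * (integral {0..R} g + 1)) * t"
proof -
  obtain q H where q: "continuous_on UNIV q" "\<And>t. (H has_real_derivative q t) (at t)"
    "\<And>t. 0 \<le> t \<Longrightarrow> t < R \<Longrightarrow> g t \<le> q t"
    and H: "\<And>t. t \<le> R \<Longrightarrow> 0 \<le> H t \<and> H t \<le> integral {0..R} g + 1"
    using mono_on_smooth_majorant[OF assms(1-3)] by blast
  define f' where "f' t = a + b * (integral {0..R} g + 1 - H t)" for t
  have f': "(f' has_real_derivative - b * q t) (at t)" for t
    unfolding f'_def by (auto intro!: derivative_eq_intros q)
  then have "continuous_on UNIV f'" by (blast intro: continuous_at_imp_continuous_on DERIV_isCont)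
  then obtain f where f: "f 0 = 0" "\<And>x. (f has_real_derivative f' x) (at x)"
    using real_antiderivative_exists by blast
  show thesis
  proof (rule that[OF f(2) f'])
    show "continuous_on UNIV (\<lambda>t. - b * q t)" by (intro continuous_intros q)
    show "b * g t \<le> - (- b * q t)" if "0 \<le> t" "t < R" for t
      using q(3)[OF that] assms(4) by (simp add: mult_left_mono)
    show "a * t \<le> f t \<and> f t \<le> (a + b * (integral {0..R} g + 1)) * t" if "0 \<le> t" "t \<le> R" for t
    proof (cases "t = 0")
      case False
      then have "0 < t" using that by simp
      then obtain s where s: "0 < s" "s < t" "f t - f 0 = (t - 0) * f' s"
        using MVT2[of 0 t f f'] f(2) by blast
      have "a \<le> f' s" "f' s \<le> a + b * (integral {0..R} g + 1)"
        using H[of s] s that assms(4) by (auto simp: f'_def intro!: mult_left_mono)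
      then show ?thesis using s f that by (simp add: mult.commute mult_left_mono)
    qed (simp add: f)
  qed
qed

section \<open>Testing with separated functions\<close>

text \<open>Separating the coordinate \<open>k\<close> from the others makes all mixed second
  derivatives vanish, so the Hessian is diagonal and its positive and negative parts can be read
  off.\<close>

lemma C2_on_separated:
  fixes k :: "'n::finite"
  assumes h: "\<And>t. (h has_real_derivative h' t) (at t)" "\<And>t. (h' has_real_derivative h'' t) (at t)"
    "continuous_on UNIV h''"
  shows "C2_on S (\<lambda>x::real^'n. a * (\<Sum>i\<in>UNIV - {k}. (x $ i)\<^sup>2) + h (x $ k))
    (\<lambda>x. \<chi> i. if i = k then h' (x $ k) else 2 * a * x $ i)
    (\<lambda>x. \<chi> i j. if i = j then if i = k then h'' (x $ k) else 2 * a else 0)"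
  unfolding C2_on_def
proof (intro conjI ballI)
  have comp: "((\<lambda>x. x $ i) has_derivative (\<lambda>y. y $ i)) (at x)" for i and x :: "real^'n"
    by (rule bounded_linear.has_derivative[OF bounded_linear_vec_nth has_derivative_ident])
  have hk: "((\<lambda>x. f (x $ k)) has_derivative (\<lambda>y. f' * y $ k)) (at x)"
    if "(f has_real_derivative f') (at (x $ k))" for f f' and x :: "real^'n"
    using has_derivative_compose[OF comp[of k x], of f "(*) f'"] that
    by (simp add: has_field_derivative_def)
  fix x :: "real^'n"
  have "((\<lambda>x. a * (\<Sum>i\<in>UNIV - {k}. (x $ i)\<^sup>2) + h (x $ k)) has_derivative
      (\<lambda>y. a * (\<Sum>i\<in>UNIV - {k}. 2 * x $ i * y $ i) + h' (x $ k) * y $ k)) (at x)"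
    by (auto intro!: derivative_eq_intros comp hk h sum.cong ext simp: mult_ac)
  moreover have "a * (\<Sum>i\<in>UNIV - {k}. 2 * x $ i * y $ i) + h' (x $ k) * y $ k =
      y \<bullet> (\<chi> i. if i = k then h' (x $ k) else 2 * a * x $ i)" for y
    by (simp add: inner_vec_def sum.remove[of UNIV k] sum_distrib_left algebra_simps)
  ultimately show "GDERIV (\<lambda>x. a * (\<Sum>i\<in>UNIV - {k}. (x $ i)\<^sup>2) + h (x $ k)) x :>
      (\<chi> i. if i = k then h' (x $ k) else 2 * a * x $ i)"
    unfolding gderiv_def by (simp only:)
  have row: "((\<chi> i j. if i = j then if i = k then h'' (x $ k) else 2 * a else 0) *v y) $ i =
      (if i = k then h'' (x $ k) * y $ k else 2 * a * y $ i)" for y :: "real^'n" and i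
    by (simp add: matrix_vector_mult_def if_distrib[of "\<lambda>c. c * _"] cong: if_cong)
  show "((\<lambda>x. \<chi> i. if i = k then h' (x $ k) else 2 * a * x $ i) has_derivative
      (*v) (\<chi> i j. if i = j then if i = k then h'' (x $ k) else 2 * a else 0)) (at x)"
  proof (subst has_derivative_componentwise_within, rule ballI)
    fix b :: "real^'n" assume "b \<in> Basis"
    then have "\<exists>i. b = axis i 1" by (simp add: Basis_vec_def)
    then obtain i where b: "b = axis i 1" by blast
    show "((\<lambda>x. (\<chi> i. if i = k then h' (x $ k) else 2 * a * x $ i) \<bullet> b) has_derivative
      (\<lambda>y. ((\<chi> i j. if i = j then if i = k then h'' (x $ k) else 2 * a else 0) *v y) \<bullet> b)) (at x)"
      unfolding b cart_eq_inner_axis[symmetric] row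
      by (cases "i = k") (auto intro!: derivative_eq_intros comp hk h)
  qed
next
  show "continuous_on S (\<lambda>x. \<chi> i j. if i = j then if i = k then h'' (x $ k) else 2 * a else 0)"
  proof (intro continuous_on_vec_lambda)
    have "continuous_on S (\<lambda>x. h'' (x $ k))"
      by (rule continuous_on_compose2[OF h(3)]) (auto intro: continuous_intros)
    then show "continuous_on S (\<lambda>x. if i = j then if i = k then h'' (x $ k) else 2 * a else 0)" for i j
      by (cases "i = j"; cases "i = k") auto
  qed
qed

text \<open>The signs of \<open>a\<close> and \<open>c\<close> put the positive part on the
  coordinates other than \<open>k\<close> and the negative part on \<open>k\<close>; having disjoint
  supports, the two diagonal matrices multiply to 0.\<close>

lemma pos_neg_parts_diag:
  fixes k :: "'n::finite"
  assumes "a \<ge> 0" "c \<ge> 0"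
  defines "X \<equiv> \<chi> i j. if i = j then if i = k then - c else a else 0"
    and "P \<equiv> \<chi> i j. if i = j then if i = k then 0 else a else 0"
    and "N \<equiv> \<chi> i j. if i = j then if i = k then c else 0 else 0"
  shows "sym_mat X" "pos_neg_parts X P N" "trace P = a * (CARD('n) - 1)" "trace N = c"
proof -
  show "sym_mat X"
    by (auto simp: X_def sym_mat_def transpose_def vec_eq_iff)
  have psd: "pos_semidef (\<chi> i j. if i = j then d i else 0)" if "\<And>i. d i \<ge> 0" for d :: "'n \<Rightarrow> real"
  proof -
    have "((\<chi> i j. if i = j then d i else 0) *v v) $ i = d i * v $ i" for v :: "real^'n" and i
      by (simp add: matrix_vector_mult_def if_distrib[of "\<lambda>c. c * _"] cong: if_cong)
    then have "v \<bullet> ((\<chi> i j. if i = j then d i else 0) *v v) = (\<Sum>i\<in>UNIV. d i * (v $ i)\<^sup>2)" for v :: "real^'n"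
      by (simp add: inner_vec_def power2_eq_square mult_ac)
    then show ?thesis using that
      by (auto simp: pos_semidef_def sym_mat_def transpose_def vec_eq_iff sum_nonneg)
  qed
  show "pos_neg_parts X P N"
    unfolding pos_neg_parts_def
  proof (intro conjI)
    show "pos_semidef P" "pos_semidef N" unfolding P_def N_def using assms by (auto intro!: psd)
    show "X = P - N" by (auto simp: X_def P_def N_def vec_eq_iff)
    show "P ** N = 0"
      by (auto simp: P_def N_def vec_eq_iff matrix_matrix_mult_def intro!: sum.neutral)
  qed
  show "trace P = a * (CARD('n) - 1)" "trace N = c"
    by (auto simp: P_def N_def trace_def sum.remove[of UNIV k])
qed

text \<open>The structural bound concerns \<open>F\<close> with second argument 0 only. Because
  \<open>u x0 \<ge> 0\<close>, degenerate ellipticity, applied with the same Hessian on both sides,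
  lowers \<open>F\<close> at \<open>u x0\<close> to \<open>F\<close> at 0, which is therefore
  nonpositive as well. The bound then compares the two traces.\<close>

lemma viscosity_subsolution_test_separated:
  fixes k :: "'n::finite"
  assumes ell: "degenerate_elliptic F"
    and pucci: "\<And>p X P N. sym_mat X \<Longrightarrow> pos_neg_parts X P N \<Longrightarrow>
           - F x0 0 p X \<le> L * trace P - l * trace N"
    and sub: "viscosity_subsolution F \<Omega> u" and x0: "x0 \<in> \<Omega>" "u x0 \<ge> 0"
    and h: "\<And>t. (h has_real_derivative h' t) (at t)" "\<And>t. (h' has_real_derivative h'' t) (at t)"
      "continuous_on UNIV h''"
    and nonneg: "a \<ge> 0" "h'' (x0 $ k) \<le> 0"
    and max: "\<forall>\<^sub>F x in at x0 within \<Omega>. u x - (a * (\<Sum>i\<in>UNIV - {k}. (x $ i)\<^sup>2) + h (x $ k))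
      \<le> u x0 - (a * (\<Sum>i\<in>UNIV - {k}. (x0 $ i)\<^sup>2) + h (x0 $ k))"
  shows "l * - h'' (x0 $ k) \<le> L * (2 * a * (CARD('n) - 1))"
proof -
  define D where "D = (\<chi> i. if i = k then h' (x0 $ k) else 2 * a * x0 $ i)"
  \<comment> \<open>The double negation matches the entry \<open>- c\<close> of
    \<open>pos_neg_parts_diag\<close> with \<open>c = - h'' (x0 $ k)\<close>.\<close>
  define X :: "real^'n^'n" where "X = (\<chi> i j. if i = j then if i = k then - (- h'' (x0 $ k)) else 2 * a else 0)"
  have "F x0 (u x0) D X \<le> 0"
    using sub[unfolded viscosity_subsolution_def, THEN conjunct2, rule_format,
        OF C2_on_separated[OF h] x0(1) max]
    unfolding D_def X_def minus_minus .
  moreover have "F x0 0 D X \<le> F x0 (u x0) D X"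
  proof -
    have "sym_mat X" unfolding X_def by (rule pos_neg_parts_diag) (use assms in auto)
    moreover have "mat_le X X"
      by (auto simp: mat_le_def pos_semidef_def sym_mat_def transpose_def vec_eq_iff matrix_vector_mult_def
          inner_vec_def)
    ultimately show ?thesis using ell x0 unfolding degenerate_elliptic_def by blast
  qed
  moreover have "- F x0 0 D X \<le> L * (2 * a * (CARD('n) - 1)) - l * - h'' (x0 $ k)"
    using pucci[OF pos_neg_parts_diag(1,2), of "2 * a" "- h'' (x0 $ k)" D k]
      pos_neg_parts_diag(3,4)[of "2 * a" "- h'' (x0 $ k)" k] nonneg
    unfolding X_def by simp
  ultimately show ?thesis by simp
qed


section \<open>Geometry of the regions\<close>

lemma region_less:
  assumes "x \<in> region k \<gamma> R" "\<gamma> R > 0" "R > 0"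
  shows "0 < x $ k" "x $ k < R"
proof -
  show "0 < x $ k" using assms by (simp add: region_def halfspace_def)
  have "0 \<le> (\<Sum>i\<in>UNIV - {k}. (x $ i)\<^sup>2)" by (simp add: sum_nonneg)
  then have "(x $ k + \<gamma> R)\<^sup>2 < (R + \<gamma> R)\<^sup>2" using assms(1) by (simp add: region_def)
  then have "x $ k + \<gamma> R < R + \<gamma> R" by (rule power2_less_imp_less) (use assms in simp)
  then show "x $ k < R" by simp
qed

lemma open_halfspace: "open (halfspace k)"
  unfolding halfspace_def by (intro open_Collect_less continuous_intros)

lemma open_region: "open (region k \<gamma> R)"
  unfolding region_def Collect_conj_eq Collect_mem_eq
  by (intro open_Int open_halfspace open_Collect_less continuous_intros)

lemma bounded_region:
  assumes "\<gamma> R > 0" "R > 0"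
  shows "bounded (region k \<gamma> R)"
proof (rule boundedI)
  fix x assume x: "x \<in> region k \<gamma> R"
  have "(x $ k)\<^sup>2 \<le> (x $ k + \<gamma> R)\<^sup>2"
    using region_less[OF x assms] assms by (intro power_mono) auto
  moreover have "(norm x)\<^sup>2 = (x $ k)\<^sup>2 + (\<Sum>i\<in>UNIV - {k}. (x $ i)\<^sup>2)"
    unfolding power2_norm_eq_inner
    by (simp add: inner_vec_def sum.remove[of UNIV k] power2_eq_square)
  ultimately have "(norm x)\<^sup>2 \<le> (R + \<gamma> R)\<^sup>2" using x by (simp add: region_def)
  then show "norm x \<le> R + \<gamma> R" by (rule power2_le_imp_le) (use assms in simp)
qed

lemma closure_region_le:
  assumes "y \<in> closure (region k \<gamma> R)"
  shows "0 \<le> y $ k" "(\<Sum>i\<in>UNIV - {k}. (y $ i)\<^sup>2) + (y $ k + \<gamma> R)\<^sup>2 \<le> (R + \<gamma> R)\<^sup>2"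
proof -
  have "closure (region k \<gamma> R) \<subseteq>
      {y. 0 \<le> y $ k \<and> (\<Sum>i\<in>UNIV - {k}. (y $ i)\<^sup>2) + (y $ k + \<gamma> R)\<^sup>2 \<le> (R + \<gamma> R)\<^sup>2}"
    unfolding Collect_conj_eq
    by (intro closure_minimal closed_Int closed_Collect_le continuous_intros)
      (auto simp: region_def halfspace_def)
  with assms show "0 \<le> y $ k" "(\<Sum>i\<in>UNIV - {k}. (y $ i)\<^sup>2) + (y $ k + \<gamma> R)\<^sup>2 \<le> (R + \<gamma> R)\<^sup>2"
    by auto
qed

section \<open>Comparison with the barrier on one region\<close>

text \<open>An arbitrary positive \<open>m\<close> above \<open>bdry_sup\<close> is used because
  that extended real need not itself be positive. The right-hand side is the barrier at
  \<open>z\<close> with the profile replaced by its linear upper bound, which keeps the profile out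
  of the statement.\<close>

lemma subsolution_bound_on_region:
  fixes k :: "'n::finite" and z :: "real^'n"
  assumes ell: "degenerate_elliptic F"
    and pucci: "\<And>x p X P N. x $ k \<ge> 0 \<Longrightarrow> sym_mat X \<Longrightarrow> pos_neg_parts X P N \<Longrightarrow>
           - F x 0 p X \<le> Lam (x $ k) * trace P - lam (x $ k) * trace N"
    and lam: "\<And>s. s \<ge> 0 \<Longrightarrow> lam s > 0" and Lam: "\<And>s. s \<ge> 0 \<Longrightarrow> Lam s > 0"
    and anti: "antimono_on {0..} lam" and mono: "mono_on {0..} Lam"
    and sub: "viscosity_subsolution F (halfspace k) u"
    and bd: "\<And>y. y \<in> frontier (halfspace k) \<Longrightarrow>
           Limsup (at y within halfspace k) (\<lambda>x. ereal (u x)) \<le> 0"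
    and R: "R > 0" "\<gamma> R > 0" and z: "z \<in> region k \<gamma> R"
    and m: "m > 0" "bdry_sup k \<gamma> u R \<le> ereal m"
  defines "A \<equiv> 2 / (R\<^sup>2 + 2 * R * \<gamma> R)"
  shows "u z \<le> m * (A * (\<Sum>i\<in>UNIV - {k}. (z $ i)\<^sup>2) +
    (2 / R + 2 * A * CARD('n) * (integral {0..R} (\<lambda>s. Lam s / lam s) + 1)) * z $ k)"
proof (rule ccontr)
  assume contra: "\<not> ?thesis"
  let ?D = "region k \<gamma> R" and ?S = "\<lambda>x::real^'n. \<Sum>i\<in>UNIV - {k}. (x $ i)\<^sup>2"
  have A: "A > 0" using R by (auto simp: A_def intro!: divide_pos_pos add_pos_pos)
  \<comment> \<open>The bracket is \<open>(R + \<gamma> R)^2 - (\<gamma> R)^2\<close>, the squared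
    radius of the flat face. Thus \<open>A * ?S\<close> equals 2 on the rim, and this factor 2 is
    the slack that keeps it at least 1 up to height \<open>R / 2\<close>.\<close>
  have AR: "A * (R\<^sup>2 + 2 * R * \<gamma> R) = 2"
  proof -
    have "0 < R\<^sup>2 + 2 * R * \<gamma> R" using R by (intro add_pos_pos) auto
    then show ?thesis unfolding A_def by (subst nonzero_eq_divide_eq[symmetric]) auto
  qed
  have mono_quot: "mono_on {0..R} (\<lambda>s. Lam s / lam s)"
  proof (rule mono_onI)
    fix r s assume "r \<in> {0..R}" "s \<in> {0..R}" "r \<le> s"
    then show "Lam r / lam r \<le> Lam s / lam s"
      using monotone_onD[OF anti, of r s] monotone_onD[OF mono, of r s] lam[of s] Lam[of s]
      by (intro frac_le) auto
  qed
  have pos_quot: "0 < Lam s / lam s" if "s \<in> {0..R}" for s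
    using that lam Lam by auto
  \<comment> \<open>The curvature coefficient carries the full dimension n, while the trace of the
    positive part has the factor n - 1. This surplus makes the final contradiction strict, also for
    n = 1.\<close>
  have slope: "0 \<le> 2 * A * CARD('n)" using A by simp
  obtain f f' f'' where f: "\<And>t. (f has_real_derivative f' t) (at t)"
    "\<And>t. (f' has_real_derivative f'' t) (at t)" "continuous_on UNIV f''"
    and f'': "\<And>t. 0 \<le> t \<Longrightarrow> t < R \<Longrightarrow> 2 * A * CARD('n) * (Lam t / lam t) \<le> - f'' t"
    and f_bd: "\<And>t. 0 \<le> t \<Longrightarrow> t \<le> R \<Longrightarrow> 2 / R * t \<le> f t \<and>
      f t \<le> (2 / R + 2 * A * CARD('n) * (integral {0..R} (\<lambda>s. Lam s / lam s) + 1)) * t"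
    by (rule concave_profile[OF R(1) mono_quot pos_quot slope, where a = "2 / R"]) (assumption, rule that)
  define w where "w x = m * A * ?S x + m * f (x $ k)" for x
  have S_nonneg: "0 \<le> ?S x" for x by (simp add: sum_nonneg)
  have w_nonneg: "0 \<le> w x" if "0 \<le> x $ k" "x $ k \<le> R" for x
  proof -
    have "0 \<le> 2 / R * x $ k" using that R by simp
    then have "0 \<le> f (x $ k)" using f_bd[OF that] by linarith
    then show ?thesis using m A S_nonneg by (simp add: w_def)
  qed
  have zk: "0 < z $ k" "z $ k < R" using region_less[OF z] R by auto
  have "u z - w z > 0"
  proof -
    have "f (z $ k) \<le> (2 / R + 2 * A * CARD('n) * (integral {0..R} (\<lambda>s. Lam s / lam s) + 1)) * z $ k"
      using f_bd zk by simp
    then have "w z \<le> m * (A * ?S z +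
        (2 / R + 2 * A * CARD('n) * (integral {0..R} (\<lambda>s. Lam s / lam s) + 1)) * z $ k)"
      using m by (simp add: w_def distrib_left mult.assoc)
    with contra show ?thesis by linarith
  qed
  have D_sub: "?D \<subseteq> halfspace k" by (auto simp: region_def)
  have f_cont: "continuous_on UNIV f"
    using f(1) by (blast intro: continuous_at_imp_continuous_on DERIV_isCont)
  have "usc_on (halfspace k) (\<lambda>x. u x - w x)"
    unfolding w_def
    using sub by (intro usc_on_diff_continuous continuous_intros continuous_on_compose2[OF f_cont])
      (auto simp: viscosity_subsolution_def)
  note usc = this usc_on_subset[OF this D_sub]
  have w_sphere: "m \<le> w y"
    if "y \<in> frontier ?D" "0 < y $ k" for y
  proof -
    have "y \<in> closure ?D" "y \<notin> ?D"
      using that open_region[of k \<gamma> R] by (auto simp: frontier_def interior_open)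
    \<comment> \<open>A frontier point satisfies the closed inequality and, lying outside the open
      region at positive height, fails the strict one.\<close>
    then have *: "?S y + (y $ k + \<gamma> R)\<^sup>2 = (R + \<gamma> R)\<^sup>2"
      using closure_region_le(2)[of y k \<gamma> R] that by (auto simp: region_def halfspace_def)
    then have "(y $ k + \<gamma> R)\<^sup>2 \<le> (R + \<gamma> R)\<^sup>2" using S_nonneg[of y] by linarith
    then have "y $ k + \<gamma> R \<le> R + \<gamma> R" by (rule power2_le_imp_le) (use R in simp)
    then have yR: "y $ k \<le> R" by simp
    have fy: "2 / R * y $ k \<le> f (y $ k)" using f_bd that yR by simp
    have "1 \<le> A * ?S y + f (y $ k)"
    proof (cases "y $ k \<le> R / 2")
      case True
      then have "(y $ k)\<^sup>2 \<le> (R / 2)\<^sup>2" using that by (intro power_mono) auto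
      then have "(y $ k)\<^sup>2 \<le> R\<^sup>2 / 4" by (simp add: power_divide)
      moreover have "2 * (\<gamma> R * y $ k) \<le> R * \<gamma> R" using True R by simp
      moreover have "?S y = R\<^sup>2 + 2 * (R * \<gamma> R) - (y $ k)\<^sup>2 - 2 * (\<gamma> R * y $ k)"
        using * by (simp add: power2_sum algebra_simps)
      moreover have "0 \<le> R\<^sup>2" by simp
      \<comment> \<open>Up to height \<open>R / 2\<close> the two subtracted terms are at most
        \<open>R^2 / 4\<close> and \<open>R * \<gamma> R\<close>, so what remains of
        \<open>?S y\<close> is at least \<open>1 / A\<close>.\<close>
      ultimately have "R\<^sup>2 / 2 + R * \<gamma> R \<le> ?S y" by linarith
      then have "(R\<^sup>2 + 2 * R * \<gamma> R) / 2 \<le> ?S y" by (simp add: add_divide_distrib)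
      then have "A * ((R\<^sup>2 + 2 * R * \<gamma> R) / 2) \<le> A * ?S y" using A by simp
      then have "1 \<le> A * ?S y" using AR by simp
      moreover have "0 \<le> 2 / R * y $ k" using that R by simp
      ultimately show ?thesis using fy by linarith
    next
      case False
      then have "1 \<le> 2 / R * y $ k" using R by (simp add: field_simps)
      moreover have "0 \<le> A * ?S y" using A S_nonneg by simp
      ultimately show ?thesis using fy by linarith
    qed
    then have "m * 1 \<le> m * (A * ?S y + f (y $ k))" using m by (intro mult_left_mono) auto
    then show ?thesis by (simp add: w_def algebra_simps)
  qed
  \<comment> \<open>At points of positive height \<open>bdry_sup\<close> gives
    \<open>u y \<le> m \<le> w y\<close>. At points of the hyperplane, rim included, the limsup
    hypothesis bounds \<open>u\<close>, and \<open>w\<close> is nonnegative inside the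
    region.\<close>
  have "\<forall>\<^sub>F x in at y within ?D. u x - w x < u z - w z" if "y \<in> closure ?D - ?D" for y
  proof (cases "y \<in> halfspace k")
    case True
    have fr: "y \<in> frontier ?D" using that open_region[of k \<gamma> R] by (auto simp: frontier_def interior_open)
    have "boundary_ext k u y \<le> ereal m"
      using m(2) fr unfolding bdry_sup_def by (meson SUP_le_iff)
    then have "u y \<le> m" using True by (simp add: boundary_ext_def)
    then have "u y - w y < u z - w z"
      using w_sphere[OF fr] True \<open>u z - w z > 0\<close> by (simp add: halfspace_def)
    \<comment> \<open>Semicontinuity is used on the half-space, as \<open>y\<close> is not in the
      region, and only then restricted.\<close>
    then have "\<forall>\<^sub>F x in at y within halfspace k. u x - w x < u z - w z"
      using usc(1) True unfolding usc_on_def by blast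
    then show ?thesis using at_le[OF D_sub] by (rule filter_leD[rotated])
  next
    case False
    have "y \<in> closure (halfspace k)" using that closure_mono[OF D_sub] by blast
    then have "y \<in> frontier (halfspace k)"
      using False open_halfspace[of k] by (simp add: frontier_def interior_open)
    then have "Limsup (at y within halfspace k) (\<lambda>x. ereal (u x)) < ereal (u z - w z)"
      using bd \<open>u z - w z > 0\<close> by (metis ereal_less(2) le_less_trans)
    then have "\<forall>\<^sub>F x in at y within halfspace k. ereal (u x) < ereal (u z - w z)"
      by (rule Limsup_lessD)
    then have "\<forall>\<^sub>F x in at y within ?D. ereal (u x) < ereal (u z - w z)"
      using at_le[OF D_sub] by (rule filter_leD[rotated])
    moreover have "\<forall>\<^sub>F x in at y within ?D. x \<in> ?D"
      by (auto simp: eventually_at_topological)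
    ultimately show ?thesis
    proof eventually_elim
      case (elim x)
      then have "0 \<le> w x" using region_less[of x k \<gamma> R] R by (intro w_nonneg) auto
      with elim show ?case by simp
    qed
  qed
  then obtain x0 where x0: "x0 \<in> ?D" and max: "\<And>y. y \<in> ?D \<Longrightarrow> u y - w y \<le> u x0 - w x0"
    using usc_attains_max_off_boundary[of "closure ?D" ?D z "\<lambda>x. u x - w x"] usc(2) z
      bounded_region[of \<gamma> R k] R closure_subset[of ?D] by (auto simp: compact_closure)
  have x0k: "0 < x0 $ k" "x0 $ k < R" using region_less[OF x0] R by auto
  \<comment> \<open>This sign is what permits replacing \<open>u x0\<close> by 0 in
    \<open>F\<close>.\<close>
  have "u x0 \<ge> 0" using max[OF z] \<open>u z - w z > 0\<close> w_nonneg[of x0] x0k by linarith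
  have loc: "\<forall>\<^sub>F x in at x0 within halfspace k. u x - (m * A * ?S x + m * f (x $ k))
      \<le> u x0 - (m * A * ?S x0 + m * f (x0 $ k))"
    using max open_region[of k \<gamma> R] x0 unfolding w_def eventually_at_topological by blast
  have f''neg: "2 * A * CARD('n) * (Lam (x0 $ k) / lam (x0 $ k)) \<le> - f'' (x0 $ k)"
    using f''[of "x0 $ k"] x0k by simp
  have pos: "0 < lam (x0 $ k)" "0 < Lam (x0 $ k)" using lam Lam x0k by auto
  have "0 \<le> 2 * A * CARD('n) * (Lam (x0 $ k) / lam (x0 $ k))" using A pos by simp
  then have "f'' (x0 $ k) \<le> 0" using f''neg by linarith
  have upper: "lam (x0 $ k) * - (m * f'' (x0 $ k)) \<le> Lam (x0 $ k) * (2 * (m * A) * (CARD('n) - 1))"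
  proof (rule viscosity_subsolution_test_separated[OF ell _ sub _ \<open>u x0 \<ge> 0\<close> _ _ _ _ _ loc])
    show "((\<lambda>t. m * f t) has_real_derivative m * f' t) (at t)"
      "((\<lambda>t. m * f' t) has_real_derivative m * f'' t) (at t)" for t
      using f by (auto intro: DERIV_cmult)
    show "continuous_on UNIV (\<lambda>t. m * f'' t)" by (intro continuous_intros f)
    show "m * f'' (x0 $ k) \<le> 0" using \<open>f'' (x0 $ k) \<le> 0\<close> m by (simp add: mult_nonneg_nonpos)
  qed (use pucci x0 x0k D_sub A m in auto)
  have "Lam (x0 $ k) * (2 * (m * A) * CARD('n)) =
      lam (x0 $ k) * (m * (2 * A * CARD('n) * (Lam (x0 $ k) / lam (x0 $ k))))"
    using pos by (simp add: field_simps)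
  also have "\<dots> \<le> lam (x0 $ k) * (m * - f'' (x0 $ k))"
    using f''neg pos m by (intro mult_left_mono) auto
  also have "\<dots> = lam (x0 $ k) * - (m * f'' (x0 $ k))" by simp
  also note upper
  finally have "Lam (x0 $ k) * (2 * (m * A) * CARD('n)) \<le> Lam (x0 $ k) * (2 * (m * A) * (CARD('n) - 1))" .
  then have "Lam (x0 $ k) * (2 * (m * A)) \<le> 0" by (simp add: right_diff_distrib mult.assoc)
  moreover have "0 < Lam (x0 $ k) * (2 * (m * A))" using pos m A by simp
  ultimately show False by linarith
qed

section \<open>Linear growth of the boundary suprema\<close>

theorem mainTheorem5:
  fixes k :: "'n::finite"
    and F :: "real ^ 'n \<Rightarrow> real \<Rightarrow> real ^ 'n \<Rightarrow> real ^ 'n ^ 'n \<Rightarrow> real"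
    and lam Lam \<gamma> :: "real \<Rightarrow> real"
    and u :: "real ^ 'n \<Rightarrow> real"
    and xbar :: "real ^ 'n"
  assumes "degenerate_elliptic F"
    and "\<And>x p X P N. x $ k \<ge> 0 \<Longrightarrow> sym_mat X \<Longrightarrow> pos_neg_parts X P N \<Longrightarrow>
           - F x 0 p X \<le> Lam (x $ k) * trace P - lam (x $ k) * trace N"
    and "\<And>s. s \<ge> 0 \<Longrightarrow> lam s > 0"
    and "\<And>s. s \<ge> 0 \<Longrightarrow> Lam s > 0"
    and "antimono_on {0..} lam"
    and "mono_on {0..} Lam"
    and "\<And>R. R > 0 \<Longrightarrow> \<gamma> R > 0"
    and "mono_on {0<..} \<gamma>"
    and "\<exists>c>0. \<forall>R>0. integral {0..R} (\<lambda>s. Lam s / lam s) \<le> c * \<gamma> R"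
    and "viscosity_subsolution F (halfspace k) u"
    and "\<And>y. y \<in> frontier (halfspace k) \<Longrightarrow>
           Limsup (at y within halfspace k) (\<lambda>x. ereal (u x)) \<le> 0"
    and "xbar \<in> halfspace k"
    and "\<And>i. i \<noteq> k \<Longrightarrow> xbar $ i = 0"
    and "u xbar > 0"
  shows "Liminf at_top (\<lambda>R. bdry_sup k \<gamma> u R / ereal R) > 0"
proof -
  obtain c where c: "c > 0" "\<And>R. R > 0 \<Longrightarrow> integral {0..R} (\<lambda>s. Lam s / lam s) \<le> c * \<gamma> R"
    using assms(9) by blast
  define t where "t = xbar $ k"
  have t: "t > 0" using assms(12) by (simp add: t_def halfspace_def)
  \<comment> \<open>\<open>C\<close> bounds \<open>R\<close> times the barrier slope times
    \<open>t\<close>, uniformly in \<open>R\<close>; the factor 2 in \<open>\<kappa>\<close> then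
    makes \<open>\<kappa> * C\<close> equal to half of \<open>u xbar\<close>.\<close>
  define C where "C = (2 + CARD('n) * (2 * c + 4)) * t"
  have C: "C > 0" unfolding C_def using c t by (intro mult_pos_pos add_pos_nonneg) auto
  define \<kappa> where "\<kappa> = u xbar / (2 * C)"
  have \<kappa>: "\<kappa> > 0" using assms(14) C by (simp add: \<kappa>_def)
  \<comment> \<open>The threshold \<open>t + 1\<close> places \<open>xbar\<close> in the region, and
    1 lets the additive constant 2 be absorbed into \<open>2 * R\<close>.\<close>
  have "ereal \<kappa> \<le> bdry_sup k \<gamma> u R / ereal R" if "R \<ge> max 1 (t + 1)" for R
  proof (rule ccontr)
    assume small: "\<not> ereal \<kappa> \<le> bdry_sup k \<gamma> u R / ereal R"
    have R: "R \<ge> 1" "R > 0" "t < R" and g: "\<gamma> R > 0" using that assms(7) by auto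
    have m: "bdry_sup k \<gamma> u R \<le> ereal (\<kappa> * R)"
      using small R ereal_le_divide_pos[of "ereal R" "ereal \<kappa>" "bdry_sup k \<gamma> u R"]
      by (auto simp: not_le mult.commute less_imp_le)
    define I A where "I = integral {0..R} (\<lambda>s. Lam s / lam s)" and "A = 2 / (R\<^sup>2 + 2 * R * \<gamma> R)"
    have z: "xbar \<in> region k \<gamma> R"
      using assms(12,13) R g t by (auto simp: region_def t_def[symmetric] intro!: power_strict_mono)
    \<comment> \<open>The quadratic term of the barrier vanishes because \<open>xbar\<close> lies on
      the axis.\<close>
    have "u xbar \<le> \<kappa> * R * ((2 / R + 2 * A * CARD('n) * (I + 1)) * t)"
      using subsolution_bound_on_region[where m = "\<kappa> * R", OF assms(1-6,10,11) _ _ z _ m] R g \<kappa> assms(13)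
      by (simp add: t_def I_def A_def)
    also have "\<dots> \<le> \<kappa> * C"
    proof -
      \<comment> \<open>Here the integral hypothesis enters: \<open>R * A\<close> equals
        \<open>2 / (R + 2 * \<gamma> R)\<close>, whose denominator dominates
        \<open>I \<le> c * \<gamma> R\<close> up to a constant factor.\<close>
      have "R * A * (I + 1) \<le> c + 2"
      proof -
        have "A = 2 / (R * (R + 2 * \<gamma> R))" by (simp add: A_def power2_eq_square algebra_simps)
        then have "R * A = 2 / (R + 2 * \<gamma> R)" using R by simp
        then have "R * A * (I + 1) = 2 * (I + 1) / (R + 2 * \<gamma> R)" by simp
        also have "\<dots> \<le> c + 2"
        proof -
          have "2 * (I + 1) \<le> 2 * (c * \<gamma> R) + 2" using c R by (simp add: I_def)
          also have "\<dots> \<le> c * (R + 2 * \<gamma> R) + 2 * (R + 2 * \<gamma> R)"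
            using R g mult_pos_pos[OF c(1) R(2)] unfolding distrib_left by linarith
          finally show ?thesis using R g by (simp add: pos_divide_le_eq algebra_simps)
        qed
        finally show ?thesis .
      qed
      then have "2 * CARD('n) * (R * A * (I + 1)) \<le> 2 * CARD('n) * (c + 2)"
        by (intro mult_left_mono) auto
      then have "R * (2 / R + 2 * A * CARD('n) * (I + 1)) \<le> 2 + CARD('n) * (2 * c + 4)"
        using R by (simp add: algebra_simps)
      then have "\<kappa> * t * (R * (2 / R + 2 * A * CARD('n) * (I + 1))) \<le> \<kappa> * t * (2 + CARD('n) * (2 * c + 4))"
        using \<kappa> t by (intro mult_left_mono) auto
      then show ?thesis by (simp add: C_def mult_ac)
    qed
    also have "\<dots> < u xbar" using C assms(14) by (simp add: \<kappa>_def)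
    finally show False by simp
  qed
  then have "ereal \<kappa> \<le> Liminf at_top (\<lambda>R. bdry_sup k \<gamma> u R / ereal R)"
    by (intro Liminf_bounded eventually_at_top_linorderI[of "max 1 (t + 1)"])
  then show ?thesis using \<kappa> by (metis ereal_less(2) less_le_trans)
qed

end
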